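(* Let $\mathcal{I}\subset\mathbb{R}$ be an interval, let $f:\mathcal{I}\to\mathbb{R}$ be strictly increasing and continuous, let $d\ge 1$, $N\ge 1$, and let $\mathcal{M}=\mathcal{I}^d$. Let $\{\boldsymbol{x}_1,\dots,\boldsymbol{x}_N\}\subset\mathcal{M}$ be a set of points. The point $\boldsymbol{y}\in\mathcal{M}$ satisfying $$\boldsymbol{y}=\operatorname{argmin}\Big\{\sum_{j=1}^N d_f(\boldsymbol{x}_j,\boldsymbol{z})^2 \;\Big|\; \boldsymbol{z}\in\mathcal{M}\Big\}$$ is given by $$\boldsymbol{y}=\boldsymbol{f}^{-1}\Big(\frac{1}{N}\sum_{j=1}^N \boldsymbol{f}(\boldsymbol{x}_j)\Big),$$ where the identity is read componentwise, i.e. $y^i=f^{-1}\big(\frac1N\sum_{j=1}^N f(x_j^i)\big)$ for $i=1,\dots,d$.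
   Context: Superscripts denote components of vectors in $\mathbb{R}^d$, subscripts label different vectors. The map $\boldsymbol{f}:\mathcal{M}\to\mathbb{R}^d$ is defined by $\boldsymbol{f}^i(\boldsymbol{x})=f(x^i)$ for $i=1,\dots,d$; it is a bijection from $\mathcal{M}$ onto $\boldsymbol{f}(\mathcal{M})$, and $\boldsymbol{f}^{-1}$ denotes its inverse on $\boldsymbol{f}(\mathcal{M})$. The $f$-distance on $\mathcal{M}$ is defined by $d_f(\boldsymbol{x},\boldsymbol{y})^2=\sum_{k=1}^d\big(f(x^k)-f(y^k)\big)^2=\|\boldsymbol{f}(\boldsymbol{x})-\boldsymbol{f}(\boldsymbol{y})\|^2$ (Euclidean norm), with $d_f\ge 0$. *)

theory Defs
  imports "HOL-Analysis.Analysis"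
begin

definition cube :: "real set \<Rightarrow> (real ^ 'd) set" where
  "cube I = {x. \<forall>i. x $ i \<in> I}"

definition vec_fun :: "(real \<Rightarrow> real) \<Rightarrow> real ^ 'd \<Rightarrow> real ^ 'd" where
  "vec_fun f x = (\<chi> i. f (x $ i))"

text \<open>The functions are total, so the values of f outside I are arbitrary; f-distances are
  meaningful only for points of the cube, and inverses are taken relative to I and to the cube.\<close>

definition f_dist :: "(real \<Rightarrow> real) \<Rightarrow> real ^ 'd \<Rightarrow> real ^ 'd \<Rightarrow> real" where
  "f_dist f x y = sqrt (\<Sum>k\<in>UNIV. (f (x $ k) - f (y $ k))\<^sup>2)"

definition vec_fun_inv :: "real set \<Rightarrow> (real \<Rightarrow> real) \<Rightarrow> real ^ 'd \<Rightarrow> real ^ 'd" where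
  "vec_fun_inv I f = inv_into (cube I) (vec_fun f)"

lemma f_dist_eq_norm: "f_dist f x y = norm (vec_fun f x - vec_fun f y)"
  by (simp add: f_dist_def vec_fun_def norm_vec_def L2_set_def)

lemma bij_betw_vec_fun:
  assumes "strict_mono_on I f"
  shows "bij_betw (vec_fun f) (cube I) (vec_fun f ` cube I)"
proof -
  have "inj_on f I"
    using assms by (rule strict_mono_on_imp_inj_on)
  then show ?thesis
    by (auto simp: bij_betw_def inj_on_def cube_def vec_fun_def vec_eq_iff)
qed

end

theory Submission
  imports Defs
begin

text \<open>
  The map \<open>vec_fun f\<close> carries the f-distance to the Euclidean distance, so minimising the sum of
  squared f-distances over the cube is a Euclidean least-squares problem on the image
  \<open>vec_fun f ` cube I\<close>. Without the constraint to this image, that problem is settled by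
  the parallel-axis identity \<open>sum_dist_sq_mean\<close>: up to a constant, the objective is a
  positive multiple of the squared distance to the arithmetic mean, which is therefore its only
  minimiser.

  It remains to see that the mean satisfies the constraint. This is where continuity on
  an interval is used: \<open>f ` I\<close> is again an interval, so the image of the cube, being a
  product of copies of \<open>f ` I\<close>, is convex and contains the mean. Finally, strict
  monotonicity makes \<open>vec_fun f\<close> injective on the cube, which allows the minimiser to be pulled
  back uniquely, one coordinate at a time.
\<close>

text \<open>The cross terms are inner products of \<open>m - w\<close> with the deviations \<open>a j - m\<close>, and the
  deviations from the mean add up to zero.\<close>

lemma sum_dist_sq_mean:
  fixes a :: "'j \<Rightarrow> 'a::real_inner" and w :: 'a
  assumes "finite A" and "A \<noteq> {}"
  defines "m \<equiv> (1 / real (card A)) *\<^sub>R (\<Sum>j\<in>A. a j)"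
  shows "(\<Sum>j\<in>A. (norm (a j - w))\<^sup>2)
    = (\<Sum>j\<in>A. (norm (a j - m))\<^sup>2) + real (card A) * (norm (w - m))\<^sup>2"
proof -
  have "real (card A) *\<^sub>R m = (\<Sum>j\<in>A. a j)"
    using assms by simp
  then have deviations: "(\<Sum>j\<in>A. a j - m) = 0"
    by (simp add: sum_subtractf sum_constant_scaleR)
  have "(norm (a j - w))\<^sup>2
      = (norm (a j - m))\<^sup>2 + (norm (w - m))\<^sup>2 + 2 * ((a j - m) \<bullet> (m - w))" for j
    by (simp add: power2_norm_eq_inner algebra_simps inner_commute)
  then have "(\<Sum>j\<in>A. (norm (a j - w))\<^sup>2)
      = (\<Sum>j\<in>A. (norm (a j - m))\<^sup>2) + real (card A) * (norm (w - m))\<^sup>2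
        + 2 * ((\<Sum>j\<in>A. a j - m) \<bullet> (m - w))"
    by (simp add: sum.distrib inner_sum_left sum_distrib_left)
  then show ?thesis
    by (simp add: deviations)
qed

lemma mean_in_convex:
  fixes a :: "'j \<Rightarrow> 'a::real_vector"
  assumes "convex S" and "finite A" and "A \<noteq> {}" and "\<And>j. j \<in> A \<Longrightarrow> a j \<in> S"
  shows "(1 / real (card A)) *\<^sub>R (\<Sum>j\<in>A. a j) \<in> S"
proof -
  have "(\<Sum>j\<in>A. (1 / real (card A)) *\<^sub>R a j) \<in> S"
    using assms by (intro convex_sum) auto
  then show ?thesis
    by (simp add: scaleR_sum_right)
qed

lemma convex_cube:
  assumes "convex J"
  shows "convex (cube J)"
  unfolding convex_alt cube_def
  using convexD_alt[OF assms] by auto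

text \<open>A preimage of a point of \<open>cube (f ` I)\<close> is assembled by choosing one in each coordinate.\<close>

lemma vec_fun_image_cube: "vec_fun f ` cube I = cube (f ` I)"
proof
  show "vec_fun f ` cube I \<subseteq> cube (f ` I)"
    by (auto simp: cube_def vec_fun_def)
  show "cube (f ` I) \<subseteq> vec_fun f ` cube I"
  proof
    fix v :: "real ^ 'd"
    assume v: "v \<in> cube (f ` I)"
    define u :: "real ^ 'd" where "u = (\<chi> i. inv_into I f (v $ i))"
    have "u \<in> cube I"
      using v by (auto simp: u_def cube_def intro: inv_into_into)
    moreover have "v = vec_fun f u"
      using v by (simp add: u_def cube_def vec_fun_def vec_eq_iff f_inv_into_f)
    ultimately show "v \<in> vec_fun f ` cube I"
      by blast
  qed
qed

lemma convex_vec_fun_image_cube: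
  assumes "is_interval I" and "continuous_on I f"
  shows "convex (vec_fun f ` cube I)"
proof -
  have "connected (f ` I)"
    using assms by (intro connected_continuous_image) (simp_all add: is_interval_connected_1)
  then show ?thesis
    by (simp add: vec_fun_image_cube convex_cube flip: is_interval_connected_1 is_interval_convex_1)
qed

lemma vec_fun_inv_nth:
  fixes v :: "real ^ 'd"
  assumes "strict_mono_on I f" and "v \<in> vec_fun f ` cube I"
  shows "vec_fun_inv I f v $ i = inv_into I f (v $ i)"
proof -
  obtain u where u: "u \<in> cube I" "v = vec_fun f u"
    using assms(2) by blast
  have "inj_on (vec_fun f) (cube I :: (real ^ 'd) set)"
    using bij_betw_vec_fun[OF assms(1)] by (rule bij_betw_imp_inj_on)
  then have "vec_fun_inv I f v = u"
    using u by (simp add: vec_fun_inv_def)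
  moreover have "inv_into I f (v $ i) = u $ i"
    using strict_mono_on_imp_inj_on[OF assms(1)] u by (simp add: vec_fun_def cube_def)
  ultimately show ?thesis
    by simp
qed

theorem theorem2p1:
  fixes I :: "real set" and f :: "real \<Rightarrow> real"
    and N :: nat and x :: "nat \<Rightarrow> real ^ 'd" and y :: "real ^ 'd"
  assumes "is_interval I"
    and "strict_mono_on I f"
    and "continuous_on I f"
    and "N \<ge> 1"
    and "\<And>j. j \<in> {1..N} \<Longrightarrow> x j \<in> cube I"
  shows "(1 / real N) *\<^sub>R (\<Sum>j=1..N. vec_fun f (x j)) \<in> vec_fun f ` cube I
    \<and> (is_arg_min (\<lambda>z. \<Sum>j=1..N. (f_dist f (x j) z)\<^sup>2) (\<lambda>z. z \<in> cube I) y
        \<longleftrightarrow> y = vec_fun_inv I f ((1 / real N) *\<^sub>R (\<Sum>j=1..N. vec_fun f (x j))))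
    \<and> (\<forall>i. vec_fun_inv I f ((1 / real N) *\<^sub>R (\<Sum>j=1..N. vec_fun f (x j))) $ i
        = inv_into I f ((1 / real N) * (\<Sum>j=1..N. f (x j $ i))))"
proof -
  define m where "m = (1 / real N) *\<^sub>R (\<Sum>j=1..N. vec_fun f (x j))"
  define F where "F = (\<lambda>z. \<Sum>j=1..N. (f_dist f (x j) z)\<^sup>2)"
  have m_image: "m \<in> vec_fun f ` cube I"
    using mean_in_convex[OF convex_vec_fun_image_cube[OF assms(1,3)],
        of "{1..N}" "\<lambda>j. vec_fun f (x j)"] assms(4,5)
    by (simp add: m_def)
  define p where "p = vec_fun_inv I f m"
  have p_cube: "p \<in> cube I" and p_image: "vec_fun f p = m"
    using m_image by (simp_all add: p_def vec_fun_inv_def inv_into_into f_inv_into_f)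
  have inj: "inj_on (vec_fun f) (cube I :: (real ^ 'd) set)"
    using bij_betw_vec_fun[OF assms(2)] by (rule bij_betw_imp_inj_on)
  have F_eq: "F z = F p + real N * (norm (vec_fun f z - m))\<^sup>2" for z
    unfolding F_def f_dist_eq_norm p_image
    using sum_dist_sq_mean[of "{1..N}" "\<lambda>j. vec_fun f (x j)" "vec_fun f z"] assms(4)
    by (simp add: m_def)
  have F_less: "F p < F z" if "z \<in> cube I" "z \<noteq> p" for z
  proof -
    have "vec_fun f z \<noteq> m"
      using that p_cube p_image inj by (auto dest: inj_onD)
    then show ?thesis
      using F_eq[of z] assms(4) by simp
  qed
  have "is_arg_min F (\<lambda>z. z \<in> cube I) y \<longleftrightarrow> y = p"
    using p_cube F_less by (force simp: is_arg_min_def)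
  moreover have "p $ i = inv_into I f ((1 / real N) * (\<Sum>j=1..N. f (x j $ i)))" for i
    using vec_fun_inv_nth[OF assms(2) m_image] by (simp add: p_def m_def vec_fun_def)
  ultimately show ?thesis
    using m_image unfolding F_def p_def m_def by blast
qed

end
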